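(* Let $I$ be a (proper) monomial ideal of the polynomial ring $S=K[x_1,\ldots,x_n]$ over a field $K$. Then $\underline{f}$ is a linear system of parameters for $S/I$ if and only if $\underline{f}$ is a linear system of parameters for $S/\mathrm{rad}(I)$.
   Context: With $\mathfrak m=(x_1,\ldots,x_n)$ and $J$ a monomial ideal of $S$, a set $\underline{f}=\{f_1,\ldots,f_d\}$ of linear forms of $S$ is a linear system of parameters for $S/J$ if $d=\dim(S/J)$ and $\mathrm{rad}(J,f_1,\ldots,f_d)=\mathfrak m$. $\mathrm{rad}(I)$ is the radical of $I$. *)

theory Defs
  imports
    "HOL-Library.Poly_Mapping"
    "HOL-Library.Extended_Nat"
    "HOL-Algebra.QuotRing"
    "HOL-Algebra.Algebraic_Closure_Type"
begin

section \<open>Radicals and Krull dimension\<close>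

definition ideal_radical :: "('a, 'b) ring_scheme \<Rightarrow> 'a set \<Rightarrow> 'a set" where
  "ideal_radical R J = {a \<in> carrier R. \<exists>k::nat. k > 0 \<and> a [^]\<^bsub>R\<^esub> k \<in> J}"

text \<open>
  The supremum of the lengths \<open>m\<close> of chains \<open>P 0 \<subset> \<dots> \<subset> P m\<close> of prime ideals; infinite dimension is
  the value \<open>\<infinity>\<close>. The zero ring, which has no prime ideals, gets the value \<open>0\<close> here
  (as the supremum of the empty set) instead of the usual \<open>-1\<close> or \<open>-\<infinity>\<close>.
\<close>

definition krull_dim :: "('a, 'b) ring_scheme \<Rightarrow> enat" where
  "krull_dim R = Sup {enat m | m.
     \<exists>P. (\<forall>i\<le>m. primeideal (P i) R) \<and> (\<forall>i<m. P i \<subset> P (Suc i))}"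

section \<open>The polynomial ring\<close>

text \<open>
  Polynomials over \<open>'k\<close> in the finitely many variables indexed by \<open>'n\<close>, as finitely supported maps
  from exponent vectors to coefficients; the number of variables is \<open>CARD('n)\<close>.
\<close>

type_synonym ('n, 'k) mv_poly = "('n \<Rightarrow>\<^sub>0 nat) \<Rightarrow>\<^sub>0 'k"

abbreviation mv_poly_ring :: "('n::finite, 'k::field) mv_poly ring" where
  "mv_poly_ring \<equiv> ring_of_type_algebra"

definition monom_of :: "('n::finite \<Rightarrow>\<^sub>0 nat) \<Rightarrow> ('n, 'k::field) mv_poly" where
  "monom_of e = Poly_Mapping.single e 1"

definition var :: "'n::finite \<Rightarrow> ('n, 'k::field) mv_poly" where
  "var i = monom_of (Poly_Mapping.single i 1)"

definition irrelevant_ideal :: "('n::finite, 'k::field) mv_poly set" where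
  "irrelevant_ideal = Idl\<^bsub>mv_poly_ring\<^esub> {var i | i. True}"

definition monomial_ideal :: "('n::finite, 'k::field) mv_poly set \<Rightarrow> bool" where
  "monomial_ideal J \<longleftrightarrow> (\<exists>E. J = Idl\<^bsub>mv_poly_ring\<^esub> (monom_of ` E))"

text \<open>The zero form counts as a linear form.\<close>

definition linear_form :: "('n::finite, 'k::field) mv_poly \<Rightarrow> bool" where
  "linear_form f \<longleftrightarrow> (\<exists>c. f = (\<Sum>i\<in>UNIV. Poly_Mapping.single 0 (c i) * var i))"

section \<open>Linear systems of parameters\<close>

text \<open>
  \<open>linear_sop J F\<close>: the set \<open>F\<close> is a linear system of parameters for the quotient of the polynomial
  ring by \<open>J\<close>. The notion is intended for monomial ideals \<open>J\<close>; this is not part of the definition.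
\<close>

definition linear_sop ::
    "('n::finite, 'k::field) mv_poly set \<Rightarrow> ('n, 'k) mv_poly set \<Rightarrow> bool" where
  "linear_sop J F \<longleftrightarrow>
     finite F \<and> (\<forall>f\<in>F. linear_form f) \<and>
     enat (card F) = krull_dim (mv_poly_ring Quot J) \<and>
     ideal_radical mv_poly_ring (Idl\<^bsub>mv_poly_ring\<^esub> (J \<union> F)) = irrelevant_ideal"

end

theory Submission
  imports Defs
begin

text \<open>
  A prime ideal contains an ideal \<open>J\<close> iff it contains the radical of \<open>J\<close>, so the quotients by \<open>J\<close>
  and by its radical have the same chains of primes and hence the same dimension. Moreover, replacing
  \<open>J\<close> by its radical does not change the radical of \<open>J + (F)\<close>.
\<close>

section \<open>Prime ideals of a quotient ring\<close>

text \<open>An ideal containing \<open>J\<close> is a union of cosets of \<open>J\<close>, so a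
  coset cannot meet it without lying in it. This reduces questions about images in the quotient to
  representatives.\<close>

lemma (in ring) rcos_image_mem_iff:
  assumes "ideal J R" "ideal P R" "J \<subseteq> P" "x \<in> carrier R"
  shows "J +> x \<in> (+>) J ` P \<longleftrightarrow> x \<in> P"
proof -
  have "\<Union> ((+>) J ` P) = P"
    using ideal_incl_iff[OF assms(1,2)] assms(3) by auto
  moreover have "(+>) J ` P \<subseteq> carrier (R Quot J)"
    using ring_ideal_imp_quot_ideal[OF assms(1,2)]
    by (simp add: additive_subgroup.a_subset ideal.axioms(1))
  ultimately show ?thesis
    using canonical_proj_vimage_mem_iff[OF assms(1) _ assms(4), of "(+>) J ` P"] by simp
qed

lemma (in cring) primeideal_rcos_image:
  assumes J: "ideal J R" and P: "primeideal P R" and JP: "J \<subseteq> P"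
  shows "primeideal ((+>) J ` P) (R Quot J)"
proof (rule primeidealI)
  interpret P: primeideal P R by (rule P)
  note mem = rcos_image_mem_iff[OF J P.is_ideal JP]
  have car: "carrier (R Quot J) = (+>) J ` carrier R"
    by (auto simp: FactRing_def A_RCOSETS_def')
  show "ideal ((+>) J ` P) (R Quot J)"
    by (rule ring_ideal_imp_quot_ideal[OF J P.is_ideal])
  show "cring (R Quot J)"
    by (rule ideal.quotient_is_cring[OF J is_cring])
  obtain x where "x \<in> carrier R" "x \<notin> P"
    using P.I_notcarr P.a_subset by blast
  then have "J +> x \<in> carrier (R Quot J)" "J +> x \<notin> (+>) J ` P"
    by (simp_all add: car mem)
  then show "carrier (R Quot J) \<noteq> (+>) J ` P" by metis
  fix a b
  assume "a \<in> carrier (R Quot J)" "b \<in> carrier (R Quot J)" and ab: "a \<otimes>\<^bsub>R Quot J\<^esub> b \<in> (+>) J ` P"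
  then obtain x y where x: "x \<in> carrier R" "a = J +> x" and y: "y \<in> carrier R" "b = J +> y"
    unfolding car by (elim imageE) simp
  then have "J +> (x \<otimes> y) \<in> (+>) J ` P"
    using ab ring_hom_mult[OF ideal.rcos_ring_hom[OF J]] by simp
  then show "a \<in> (+>) J ` P \<or> b \<in> (+>) J ` P"
    using x y P.I_prime[of x y] by (simp add: mem)
qed

text \<open>The correspondence for all ideals restricts to primes: primeness goes forward on
  representatives and back along the projection.\<close>

lemma (in cring) quot_primeideal_correspondence:
  assumes J: "ideal J R"
  shows "bij_betw (\<lambda>P. (+>) J ` P) {P. primeideal P R \<and> J \<subseteq> P} {Q. primeideal Q (R Quot J)}"
proof -
  let ?f = "\<lambda>P. (+>) J ` P"
  note bij = quot_ideal_correspondence[OF J]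
  have "inj_on ?f {P. primeideal P R \<and> J \<subseteq> P}"
    using bij_betw_imp_inj_on[OF bij] by (rule inj_on_subset) (auto simp: primeideal_def)
  moreover have "?f ` {P. primeideal P R \<and> J \<subseteq> P} = {Q. primeideal Q (R Quot J)}"
  proof safe
    fix Q assume Q: "primeideal Q (R Quot J)"
    then have "Q \<in> ?f ` {P. ideal P R \<and> J \<subseteq> P}"
      by (simp add: bij_betw_imp_surj_on[OF bij] primeideal_def)
    then obtain P where P: "ideal P R" "J \<subseteq> P" "Q = ?f P"
      by (elim imageE CollectE conjE) (rule that)
    have "P \<subseteq> carrier R"
      using P(1) by (simp add: additive_subgroup.a_subset ideal.axioms(1))
    \<comment> \<open>The preimage of \<open>Q\<close> under the projection is \<open>P\<close>
      itself, so \<open>P\<close> inherits primeness as a preimage.\<close>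
    then have "{r \<in> carrier R. J +> r \<in> Q} = P"
      using rcos_image_mem_iff[OF J P(1,2)] by (simp add: P(3) set_eq_iff) (meson subsetD)
    then have "primeideal P R"
      using ring_hom_ring.primeideal_vimage[OF ideal.rcos_ring_hom_ring[OF J] is_cring Q] by simp
    then show "Q \<in> ?f ` {P. primeideal P R \<and> J \<subseteq> P}"
      using P(2,3) by simp
  qed (rule primeideal_rcos_image[OF J])
  ultimately show ?thesis by (simp add: bij_betw_def)
qed

text \<open>This removes the quotient from the dimension: the right-hand side depends on
  \<open>J\<close> only through the primes above it, so two ideals of the same ring can be
  compared.\<close>

lemma (in cring) krull_dim_Quot:
  assumes J: "ideal J R"
  shows "krull_dim (R Quot J) = Sup {enat m | m.
    \<exists>P. (\<forall>i\<le>m. primeideal (P i) R \<and> J \<subseteq> P i) \<and> (\<forall>i<m. P i \<subset> P (Suc i))}"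
proof -
  let ?f = "\<lambda>P. (+>) J ` P"
  let ?A = "{P. primeideal P R \<and> J \<subseteq> P}"
  note bij = quot_primeideal_correspondence[OF J]
  \<comment> \<open>A bijection need not respect order. The coset test for \<open>P'\<close> matches
    weak inclusions, and injectivity matches equalities.\<close>
  have strict: "?f P \<subset> ?f P' \<longleftrightarrow> P \<subset> P'" if "P \<in> ?A" "P' \<in> ?A" for P P'
  proof -
    have "P \<subseteq> carrier R"
      using that(1) additive_subgroup.a_subset ideal.axioms(1) primeideal.axioms(1) by blast
    moreover have "ideal P' R" "J \<subseteq> P'"
      using that(2) by (simp_all add: primeideal_def)
    ultimately have "?f P \<subseteq> ?f P' \<longleftrightarrow> P \<subseteq> P'"
      unfolding image_subset_iff using rcos_image_mem_iff[OF J, of P'] by (metis subset_iff)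
    then show ?thesis
      using that inj_on_eq_iff[OF bij_betw_imp_inj_on[OF bij]] by (simp add: psubset_eq)
  qed
  have "(\<exists>Q. (\<forall>i\<le>m. primeideal (Q i) (R Quot J)) \<and> (\<forall>i<m. Q i \<subset> Q (Suc i))) \<longleftrightarrow>
        (\<exists>P. (\<forall>i\<le>m. primeideal (P i) R \<and> J \<subseteq> P i) \<and> (\<forall>i<m. P i \<subset> P (Suc i)))"
    (is "(\<exists>Q. ?chainQ Q) \<longleftrightarrow> (\<exists>P. ?chainP P)") for m :: nat
  proof
    assume "\<exists>Q. ?chainQ Q"
    then obtain Q where Q: "?chainQ Q" by blast
    \<comment> \<open>Preimages are chosen index by index; \<open>strict\<close> then recovers the
      order of the chain.\<close>
    have "\<forall>i\<le>m. \<exists>P. P \<in> ?A \<and> Q i = ?f P"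
    proof (intro allI impI)
      fix i assume "i \<le> m"
      then have "Q i \<in> ?f ` ?A"
        using Q by (simp add: bij_betw_imp_surj_on[OF bij])
      then show "\<exists>P. P \<in> ?A \<and> Q i = ?f P" by (elim imageE) (intro exI conjI)
    qed
    then obtain P where P: "\<And>i. i \<le> m \<Longrightarrow> P i \<in> ?A \<and> Q i = ?f (P i)"
      by metis
    have "P i \<subset> P (Suc i)" if "i < m" for i
    proof -
      have "?f (P i) \<subset> ?f (P (Suc i))"
        using P[of i] P[of "Suc i"] Q that by (metis Suc_leI less_imp_le)
      then show ?thesis
        using strict P[of i] P[of "Suc i"] that by simp
    qed
    then show "\<exists>P. ?chainP P"
      using P by blast
  next
    assume "\<exists>P. ?chainP P"
    then obtain P where P: "?chainP P" by blast
    have "?chainQ (\<lambda>i. ?f (P i))"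
      using P strict primeideal_rcos_image[OF J] by (simp add: less_imp_le)
    then show "\<exists>Q. ?chainQ Q" by (rule exI[of _ "\<lambda>i. ?f (P i)"])
  qed
  then show ?thesis by (simp add: krull_dim_def)
qed

section \<open>Radicals of ideals\<close>

lemma (in primeideal) nat_pow_mem_imp_mem:
  assumes "a \<in> carrier R" "a [^] (k::nat) \<in> I"
  shows "a \<in> I"
  using assms(2)
proof (induction k)
  \<comment> \<open>The power is \<open>\<one>\<close> here, which a proper ideal cannot
    contain.\<close>
  case 0
  then show ?case using one_imp_carrier I_notcarr by simp
next
  case (Suc k)
  then show ?case using I_prime[of "a [^] k" a] assms(1) by auto
qed

lemma (in ideal) subset_ideal_radical: "I \<subseteq> ideal_radical R I"
proof
  fix a assume "a \<in> I"
  then have "a \<in> carrier R" "a [^] (1::nat) \<in> I" by simp_all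
  then show "a \<in> ideal_radical R I"
    unfolding ideal_radical_def by blast
qed

lemma ideal_radical_mono: "J \<subseteq> K \<Longrightarrow> ideal_radical R J \<subseteq> ideal_radical R K"
  by (auto simp: ideal_radical_def)

lemma (in ring) ideal_radical_idem: "ideal_radical R (ideal_radical R J) = ideal_radical R J"
proof
  show "ideal_radical R (ideal_radical R J) \<subseteq> ideal_radical R J"
  proof
    fix a assume "a \<in> ideal_radical R (ideal_radical R J)"
    then obtain k l :: nat where "a \<in> carrier R" "0 < k" "0 < l" "(a [^] k) [^] l \<in> J"
      by (auto simp: ideal_radical_def)
    then have "a \<in> carrier R" "0 < k * l" "a [^] (k * l) \<in> J"
      by (simp_all add: nat_pow_pow)
    then show "a \<in> ideal_radical R J"
      unfolding ideal_radical_def by blast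
  qed
  show "ideal_radical R J \<subseteq> ideal_radical R (ideal_radical R J)"
  proof
    fix a assume "a \<in> ideal_radical R J"
    moreover from this have "a \<in> carrier R" by (simp add: ideal_radical_def)
    moreover from this have "a [^] (1::nat) = a" by simp
    ultimately have "a \<in> carrier R \<and> 0 < (1::nat) \<and> a [^] (1::nat) \<in> ideal_radical R J" by simp
    then show "a \<in> ideal_radical R (ideal_radical R J)"
      unfolding ideal_radical_def[of R "ideal_radical R J"] by blast
  qed
qed

lemma (in primeideal) ideal_radical_subset_iff:
  assumes "ideal J R"
  shows "ideal_radical R J \<subseteq> I \<longleftrightarrow> J \<subseteq> I"
  using ideal.subset_ideal_radical[OF assms] nat_pow_mem_imp_mem
  by (auto simp: ideal_radical_def)

text \<open>
  The powers of \<open>a\<close> and \<open>b\<close> in front let the sum be expanded one factor at a time, which replaces the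
  binomial theorem.
\<close>

lemma (in cring) mult_pow_add_mem_ideal:
  assumes J: "ideal J R" and a: "a \<in> carrier R" and b: "b \<in> carrier R"
    and ak: "a [^] (k::nat) \<in> J" and bl: "b [^] (l::nat) \<in> J"
  shows "k + l \<le> i + j + m \<Longrightarrow> a [^] i \<otimes> b [^] j \<otimes> (a \<oplus> b) [^] (m::nat) \<in> J"
proof (induction m arbitrary: i j)
  interpret J: ideal J R by (rule J)
  case 0
  \<comment> \<open>With no factor \<open>a \<oplus> b\<close> left, the bound forces one of the
    front powers into \<open>J\<close>.\<close>
  then consider "k \<le> i" | "l \<le> j" by linarith
  then have "a [^] i \<otimes> b [^] j \<in> J"
  proof cases
    case 1
    then have "a [^] i = a [^] k \<otimes> a [^] (i - k)" using a by (simp add: nat_pow_mult)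
    then show ?thesis using ak a b by (simp add: J.I_r_closed)
  next
    case 2
    then have "b [^] j = b [^] l \<otimes> b [^] (j - l)" using b by (simp add: nat_pow_mult)
    then show ?thesis using bl a b by (simp add: J.I_r_closed J.I_l_closed)
  qed
  then show ?case using a b by simp
next
  interpret J: ideal J R by (rule J)
  case (Suc m)
  let ?c = "(a \<oplus> b) [^] m"
  \<comment> \<open>Expanding one factor raises \<open>i\<close> or \<open>j\<close> by one as
    \<open>m\<close> drops by one, so the bound on \<open>i + j + m\<close> carries over to both
    summands.\<close>
  have "a [^] i \<otimes> b [^] j \<otimes> (a \<oplus> b) [^] Suc m =
      a [^] Suc i \<otimes> b [^] j \<otimes> ?c \<oplus> a [^] i \<otimes> b [^] Suc j \<otimes> ?c"
    using a b by (simp add: l_distr r_distr m_ac)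
  moreover have "a [^] Suc i \<otimes> b [^] j \<otimes> ?c \<in> J" "a [^] i \<otimes> b [^] Suc j \<otimes> ?c \<in> J"
    using Suc.prems Suc.IH[of "Suc i" j] Suc.IH[of i "Suc j"] by (simp_all del: nat_pow_Suc)
  ultimately show ?case by (simp add: J.a_closed)
qed

lemma (in cring) ideal_ideal_radical:
  assumes J: "ideal J R"
  shows "ideal (ideal_radical R J) R"
proof -
  interpret J: ideal J R by (rule J)
  \<comment> \<open>Proved ahead of the subgroup axioms because closure under negation follows from
    it with the factor \<open>\<ominus> \<one>\<close>.\<close>
  have mult: "x \<otimes> a \<in> ideal_radical R J" if "a \<in> ideal_radical R J" "x \<in> carrier R" for a x
    using that by (auto simp: ideal_radical_def nat_pow_distrib intro: J.I_l_closed)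
  show ?thesis
  proof (rule idealI[OF ring_axioms])
    show "subgroup (ideal_radical R J) (add_monoid R)"
    proof (rule add.subgroupI)
      show "ideal_radical R J \<subseteq> carrier R" by (auto simp: ideal_radical_def)
      show "ideal_radical R J \<noteq> {}"
        using J.subset_ideal_radical J.zero_closed by blast
    next
      fix a assume a: "a \<in> ideal_radical R J"
      then have "a \<in> carrier R" by (simp add: ideal_radical_def)
      then have "\<ominus> a = (\<ominus> \<one>) \<otimes> a" by (simp add: l_minus)
      then show "\<ominus> a \<in> ideal_radical R J" using mult[OF a, of "\<ominus> \<one>"] by simp
    next
      fix a b assume "a \<in> ideal_radical R J" "b \<in> ideal_radical R J"
      then obtain k l :: nat where "a \<in> carrier R" "b \<in> carrier R" "0 < k"
        and "a [^] k \<in> J" "b [^] l \<in> J"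
        by (auto simp: ideal_radical_def)
      then show "a \<oplus> b \<in> ideal_radical R J"
        using mult_pow_add_mem_ideal[OF J, of a b k l 0 0 "k + l"]
        by (auto simp: ideal_radical_def intro!: exI[of _ "k + l"])
    qed
  next
    fix a x assume ax: "a \<in> ideal_radical R J" "x \<in> carrier R"
    show "x \<otimes> a \<in> ideal_radical R J" by (rule mult[OF ax])
    then show "a \<otimes> x \<in> ideal_radical R J"
      using ax m_comm[of a x] by (simp add: ideal_radical_def)
  qed
qed

section \<open>Passing from an ideal to its radical\<close>

lemma (in cring) krull_dim_Quot_ideal_radical:
  assumes "ideal J R"
  shows "krull_dim (R Quot ideal_radical R J) = krull_dim (R Quot J)"
proof -
  have "primeideal P R \<and> ideal_radical R J \<subseteq> P \<longleftrightarrow> primeideal P R \<and> J \<subseteq> P" for P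
    using primeideal.ideal_radical_subset_iff[OF _ assms] by blast
  then show ?thesis
    by (simp add: krull_dim_Quot[OF assms] krull_dim_Quot[OF ideal_ideal_radical[OF assms]])
qed

text \<open>For the nontrivial inclusion, the radical of \<open>Idl (J \<union> F)\<close> is an
  ideal containing both \<open>ideal_radical R J\<close> and \<open>F\<close>, hence the ideal they
  generate; idempotence absorbs the second radical.\<close>

lemma (in cring) ideal_radical_genideal_radical_Un:
  assumes J: "ideal J R" and F: "F \<subseteq> carrier R"
  shows "ideal_radical R (Idl (ideal_radical R J \<union> F)) = ideal_radical R (Idl (J \<union> F))"
proof
  have JF: "J \<union> F \<subseteq> carrier R"
    using F additive_subgroup.a_subset[OF ideal.axioms(1)[OF J]] by blast
  note gen = genideal_ideal[OF JF]
  have "ideal_radical R J \<subseteq> ideal_radical R (Idl (J \<union> F))"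
    using genideal_self[OF JF] by (intro ideal_radical_mono) blast
  moreover have "F \<subseteq> ideal_radical R (Idl (J \<union> F))"
    using genideal_self[OF JF] ideal.subset_ideal_radical[OF gen] by blast
  ultimately have "Idl (ideal_radical R J \<union> F) \<subseteq> ideal_radical R (Idl (J \<union> F))"
    by (intro genideal_minimal ideal_ideal_radical gen) simp
  then show "ideal_radical R (Idl (ideal_radical R J \<union> F)) \<subseteq> ideal_radical R (Idl (J \<union> F))"
    using ideal_radical_mono ideal_radical_idem by metis
next
  have rad: "ideal_radical R J \<union> F \<subseteq> carrier R"
    using F by (auto simp: ideal_radical_def)
  then have "J \<union> F \<subseteq> Idl (ideal_radical R J \<union> F)"
    using genideal_self[OF rad] ideal.subset_ideal_radical[OF J] by blast
  then show "ideal_radical R (Idl (J \<union> F)) \<subseteq> ideal_radical R (Idl (ideal_radical R J \<union> F))"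
    by (intro ideal_radical_mono genideal_minimal genideal_ideal rad)
qed

theorem corollary3p6:
  fixes I F :: "('n::finite, 'k::field) mv_poly set"
  assumes "monomial_ideal I"
    and "I \<noteq> carrier mv_poly_ring"
  shows "linear_sop I F \<longleftrightarrow> linear_sop (ideal_radical mv_poly_ring I) F"
proof -
  interpret cring "mv_poly_ring :: ('n, 'k) mv_poly ring"
    by (rule cring_from_type_algebra)
  have carrier: "A \<subseteq> carrier mv_poly_ring" for A :: "('n, 'k) mv_poly set"
    by (simp add: ring_of_type_algebra_def)
  then have "ideal I mv_poly_ring"
    using assms(1) genideal_ideal by (auto simp: monomial_ideal_def)
  \<comment> \<open>Finiteness and linearity concern \<open>F\<close> alone; the two preceding
    results rewrite the dimension and radical conditions.\<close>
  then show ?thesis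
    using carrier
    by (simp add: linear_sop_def krull_dim_Quot_ideal_radical ideal_radical_genideal_radical_Un)
qed

end
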